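(* Let $R$ be a preference profile and $P$ a random assignment. Then $P$ satisfies ex-post favoring-eagerness-for-remaining-items (ep-FERI) with respect to $R$ if and only if there exists a probability distribution $\pi$ over the set of all priority orders (strict linear orders) over the agents such that $P=\mathbb E(\mathrm{ABM}^{\pi}(R))$, where $\mathrm{ABM}^\pi$ is the adaptive Boston mechanism with distribution $\pi$.
   Context: Setting. An assignment problem has a set $N=\{1,\dots,n\}$ of agents and a set $M$ of $n$ items (one unit each). A preference profile $R=(\succ_j)_{j\in N}$ gives each agent $j$ a strict linear order $\succ_j$ on $M$. For nonempty $S\subseteq M$, $\mathrm{top}(j,S)$ is the $\succ_j$-best item of $S$. A random assignment is a doubly stochastic $n\times n$ matrix $P=[p_{j,o}]_{j\in N,o\in M}$. A deterministic assignment is a bijection $A:N\to M$, identified with its permutation matrix. FERI. For a deterministic assignment $A$ define recursively for $r=1,2,\dots$: $T_{A,r}=\{o\in M: o=\mathrm{top}(j,M\setminus\bigcup_{r'<r}T_{A,r'})\text{ for some }j\in N\text{ with }A(j)\notin\bigcup_{r'<r}T_{A,r'}\}$. $A$ satisfies FERI if for every $r\ge 1$ and every $o\in T_{A,r}$, $o=\mathrm{top}(A^{-1}(o),M\setminus\bigcup_{r'<r}T_{A,r'})$. A random assignment satisfies ep-FERI if it is a convex combination of deterministic assignments satisfying FERI. Adaptive Boston mechanism $\mathrm{ABM}^\pi$. A priority order $\vartriangleright$ (a strict linear order over $N$) is drawn according to $\pi$. Start with $M'=M$, $N'=N$. While $M'\ne\emptyset$, perform a round: for each $o\in M'$ let $N_o=\{j\in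 N':\mathrm{top}(j,M')=o\}$; each $o\in M'$ with $N_o\neq\emptyset$ is allocated to the agent $j_o\in N_o$ ranked highest by $\vartriangleright$; then remove from $M'$ all items with $N_o\ne\emptyset$ and from $N'$ all the corresponding $j_o$. The result is a deterministic assignment $\mathrm{ABM}^{\vartriangleright}(R)$, and $\mathbb E(\mathrm{ABM}^\pi(R))=\sum_{\vartriangleright}\pi(\vartriangleright)\,\mathrm{ABM}^{\vartriangleright}(R)$. *)

theory Defs
  imports "HOL-Probability.Probability_Mass_Function" "HOL-Library.While_Combinator"
begin

text \<open>
  Agents and items are the elements of two finite types of equal cardinality.
  In a preference \<open>r\<close>, \<open>(x, y) \<in> r\<close> means that \<open>x\<close> is strictly preferred to \<open>y\<close>;
  in a priority order it means that \<open>x\<close> is ranked above \<open>y\<close>.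
\<close>

type_synonym ('n, 'm) profile = "'n \<Rightarrow> ('m \<times> 'm) set"

definition preference_profile :: "('n, 'm) profile \<Rightarrow> bool" where
  "preference_profile R \<longleftrightarrow> (\<forall>j. strict_linear_order (R j))"

text \<open>Only meaningful for nonempty finite \<open>S\<close> and a strict linear order \<open>r\<close>.\<close>

definition best :: "('x \<times> 'x) set \<Rightarrow> 'x set \<Rightarrow> 'x" where
  "best r S = (THE x. x \<in> S \<and> (\<forall>y\<in>S. y \<noteq> x \<longrightarrow> (x, y) \<in> r))"

definition random_assignment :: "real^'m^'n \<Rightarrow> bool" where
  "random_assignment P \<longleftrightarrow>
     (\<forall>j x. 0 \<le> P $ j $ x) \<and>
     (\<forall>j. (\<Sum>x\<in>UNIV. P $ j $ x) = 1) \<and>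
     (\<forall>x. (\<Sum>j\<in>UNIV. P $ j $ x) = 1)"

definition assignment_matrix :: "('n \<Rightarrow> 'm) \<Rightarrow> real^'m^'n" where
  "assignment_matrix A = (\<chi> j x. if A j = x then 1 else 0)"

text \<open>
  The sets \<open>T\<^sub>A\<^sub>,\<^sub>r\<close>, meaningful for \<open>r \<ge> 1\<close>. Once every item has appeared, no agent
  satisfies the side condition, so the value of \<open>best\<close> on the empty set plays no role.
\<close>

fun eager_items :: "('n, 'm) profile \<Rightarrow> ('n \<Rightarrow> 'm) \<Rightarrow> nat \<Rightarrow> 'm set" where
  "eager_items R A r =
     {x. \<exists>j. A j \<notin> (\<Union>r'\<in>{1..<r}. eager_items R A r') \<and>
             x = best (R j) (UNIV - (\<Union>r'\<in>{1..<r}. eager_items R A r'))}"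

declare eager_items.simps [simp del]

definition FERI :: "('n, 'm) profile \<Rightarrow> ('n \<Rightarrow> 'm) \<Rightarrow> bool" where
  "FERI R A \<longleftrightarrow>
     (\<forall>r\<ge>1. \<forall>x\<in>eager_items R A r.
        x = best (R (inv A x)) (UNIV - (\<Union>r'\<in>{1..<r}. eager_items R A r')))"

definition ep_FERI :: "('n::finite, 'm::finite) profile \<Rightarrow> real^'m^'n \<Rightarrow> bool" where
  "ep_FERI R P \<longleftrightarrow>
     (\<exists>w :: ('n \<Rightarrow> 'm) \<Rightarrow> real.
        (\<forall>A\<in>{A. bij A \<and> FERI R A}. 0 \<le> w A) \<and>
        (\<Sum>A\<in>{A. bij A \<and> FERI R A}. w A) = 1 \<and>
        P = (\<Sum>A\<in>{A. bij A \<and> FERI R A}. w A *\<^sub>R assignment_matrix A))"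

text \<open>
  The state of the mechanism consists of the remaining items, the remaining agents, and the
  allocations made so far as agent-item pairs.
\<close>

definition ABM_round ::
  "('n, 'm) profile \<Rightarrow> ('n \<times> 'n) set \<Rightarrow>
     'm set \<times> 'n set \<times> ('n \<times> 'm) set \<Rightarrow> 'm set \<times> 'n set \<times> ('n \<times> 'm) set" where
  "ABM_round R p = (\<lambda>(M', N', G).
     let applicants = (\<lambda>x. {j \<in> N'. best (R j) M' = x});
         taken = {x \<in> M'. applicants x \<noteq> {}};
         winner = (\<lambda>x. best p (applicants x))
     in (M' - taken, N' - winner ` taken, G \<union> (\<lambda>x. (winner x, x)) ` taken))"

definition ABM :: "('n, 'm) profile \<Rightarrow> ('n \<times> 'n) set \<Rightarrow> 'n \<Rightarrow> 'm" where
  "ABM R p =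
     (let (M', N', G) = while (\<lambda>(M', N', G). M' \<noteq> {}) (ABM_round R p) (UNIV, UNIV, {})
      in (\<lambda>j. THE x. (j, x) \<in> G))"

definition expected_ABM ::
  "('n::finite, 'm::finite) profile \<Rightarrow> ('n \<times> 'n) set pmf \<Rightarrow> real^'m^'n" where
  "expected_ABM R \<pi> =
     (\<Sum>p\<in>{p. strict_linear_order p}. pmf \<pi> p *\<^sub>R assignment_matrix (ABM R p))"

end

theory Submission
  imports Defs
begin

text \<open>
  The outcomes of the mechanism under the various priority orders are exactly the bijections
  satisfying FERI; passing to convex combinations then gives the theorem. In a run of the
  mechanism with outcome \<open>A\<close>, the items allocated in round \<open>r\<close> are those of \<open>T\<^sub>A\<^sub>,\<^sub>r\<close>, and each goes to
  an agent ranking it top among the remaining items, which is FERI. Conversely, if \<open>A\<close> satisfies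
  FERI, let the priority order rank agents by the round in which their item appears. An applicant
  for \<open>x \<in> T\<^sub>A\<^sub>,\<^sub>r\<close> other than the owner of \<open>x\<close> cannot own an item of \<open>T\<^sub>A\<^sub>,\<^sub>r\<close>, since FERI would make that
  item its top choice \<open>x\<close>; so the owner of \<open>x\<close> comes first among the applicants and wins.
\<close>

section \<open>Best elements of finite sets under a strict linear order\<close>

lemma best_eqI:
  assumes "strict_linear_order r" "x \<in> S" "\<And>y. y \<in> S \<Longrightarrow> y \<noteq> x \<Longrightarrow> (x, y) \<in> r"
  shows "best r S = x"
  unfolding best_def
proof (rule the_equality)
  fix z assume z: "z \<in> S \<and> (\<forall>y\<in>S. y \<noteq> z \<longrightarrow> (z, y) \<in> r)"
  show "z = x"
  proof (rule ccontr)
    assume "z \<noteq> x"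
    then have "(x, z) \<in> r" "(z, x) \<in> r" using z assms by auto
    then show False
      using assms(1) unfolding strict_linear_order_on_def by (meson irreflD transD)
  qed
qed (use assms in auto)

text \<open>Induction on the set: by totality an added element is either beaten by the previous best
  or beats it, and then by transitivity beats all the rest.\<close>

lemma best_in:
  assumes r: "strict_linear_order r" and S: "finite S" "S \<noteq> {}"
  shows "best r S \<in> S"
proof -
  have "\<exists>x\<in>S. \<forall>y\<in>S. y \<noteq> x \<longrightarrow> (x, y) \<in> r"
    using S
  proof (induction S rule: finite_ne_induct)
    case (insert a S)
    then obtain x where x: "x \<in> S" "\<And>y. y \<in> S \<Longrightarrow> y \<noteq> x \<Longrightarrow> (x, y) \<in> r" by blast
    have "a \<noteq> x" using x(1) insert.hyps by auto
    then have tr: "trans r" and tot: "(a, x) \<in> r \<or> (x, a) \<in> r"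
      using r by (auto simp: strict_linear_order_on_def total_on_def)
    from tot show ?case
    proof
      assume "(a, x) \<in> r"
      then have "\<forall>y\<in>insert a S. y \<noteq> a \<longrightarrow> (a, y) \<in> r"
        using x(2) tr by (metis insertE transD)
      then show ?thesis by blast
    qed (use x in auto)
  qed auto
  then show ?thesis using best_eqI[OF r] by metis
qed

section \<open>A single round of the mechanism\<close>

definition demanded :: "('n, 'm) profile \<Rightarrow> 'n set \<Rightarrow> 'm set \<Rightarrow> 'm set" where
  "demanded R N M = (\<lambda>j. best (R j) M) ` N"

definition winner ::
  "('n, 'm) profile \<Rightarrow> ('n \<times> 'n) set \<Rightarrow> 'n set \<Rightarrow> 'm set \<Rightarrow> 'm \<Rightarrow> 'n" where
  "winner R p N M x = best p {j \<in> N. best (R j) M = x}"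

lemma winner_applies:
  fixes R :: "('n::finite, 'm) profile"
  assumes "strict_linear_order p" "x \<in> demanded R N M"
  shows "winner R p N M x \<in> N" "best (R (winner R p N M x)) M = x"
proof -
  have "winner R p N M x \<in> {j \<in> N. best (R j) M = x}"
    unfolding winner_def using assms by (intro best_in) (auto simp: demanded_def)
  then show "winner R p N M x \<in> N" "best (R (winner R p N M x)) M = x" by auto
qed

text \<open>\<open>best\<close> is unspecified on the empty set, hence the condition that no agent
  is left once the items are gone.\<close>

lemma demanded_subset:
  fixes R :: "('n, 'm::finite) profile"
  assumes "preference_profile R" "M = {} \<longrightarrow> N = {}"
  shows "demanded R N M \<subseteq> M"
  using assms by (auto simp: demanded_def preference_profile_def intro!: best_in)

lemma ABM_round_eq:
  fixes R :: "('n, 'm::finite) profile"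
  assumes "preference_profile R" "M = {} \<longrightarrow> N = {}"
  shows "ABM_round R p (M, N, G) =
    (M - demanded R N M, N - winner R p N M ` demanded R N M,
     G \<union> (\<lambda>x. (winner R p N M x, x)) ` demanded R N M)"
proof -
  have "{x \<in> M. {j \<in> N. best (R j) M = x} \<noteq> {}} = demanded R N M"
    using demanded_subset[OF assms] by (auto simp: demanded_def)
  then show ?thesis
    unfolding ABM_round_def winner_def[abs_def] by (simp add: Let_def)
qed

text \<open>Invariant of the rounds: injectivity of both projections makes \<open>G\<close> the
  graph of a bijection from the removed agents onto the removed items. Equal numbers of agents and
  items therefore remain.\<close>

definition matching_state :: "'m set \<times> 'n set \<times> ('n \<times> 'm) set \<Rightarrow> bool" where
  "matching_state = (\<lambda>(M, N, G).
     inj_on fst G \<and> inj_on snd G \<and> fst ` G = - N \<and> snd ` G = - M)"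

lemma matching_state_card:
  fixes G :: "('n::finite \<times> 'm::finite) set"
  assumes "CARD('n) = CARD('m)" "matching_state (M, N, G)"
  shows "card M = card N"
proof -
  have "card (- N) = card (- M)"
    using assms(2) by (auto simp: matching_state_def dest!: card_image)
  then have "CARD('n) - card N = CARD('m) - card M"
    by (simp add: Compl_eq_Diff_UNIV card_Diff_subset)
  moreover have "card N \<le> CARD('n)" "card M \<le> CARD('m)"
    by (simp_all add: card_mono)
  ultimately show ?thesis using assms(1) by linarith
qed

lemma matching_state_round:
  fixes G :: "('n::finite \<times> 'm::finite) set"
  assumes R: "preference_profile R" and p: "strict_linear_order p"
    and MN: "M = {} \<longrightarrow> N = {}" and st: "matching_state (M, N, G)"
  shows "matching_state (ABM_round R p (M, N, G))"
proof -
  let ?D = "demanded R N M" and ?w = "winner R p N M"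
  let ?H = "(\<lambda>x. (?w x, x)) ` ?D"
  note DM = demanded_subset[OF R MN] and w = winner_applies[OF p, of _ R N M]
  from st have G: "inj_on fst G" "inj_on snd G" "fst ` G = - N" "snd ` G = - M"
    by (auto simp: matching_state_def)
  have H1: "fst ` ?H = ?w ` ?D" and H2: "snd ` ?H = ?D" by force+
  \<comment> \<open>An item is recovered from its winner as the winner's top choice in
    \<open>M\<close>, so no agent wins two items in a round.\<close>
  have "inj_on ?w ?D"
    by (rule inj_on_inverseI[of _ "\<lambda>j. best (R j) M"]) (rule w(2))
  then have "inj_on fst ?H" by (auto simp: inj_on_def)
  moreover have "fst ` G \<inter> fst ` ?H = {}" unfolding H1 G(3) using w(1) by auto
  ultimately have inj1: "inj_on fst (G \<union> ?H)" using G(1) by (auto simp: inj_on_Un)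
  have "inj_on snd ?H" by (rule inj_onI) auto
  moreover have "snd ` G \<inter> snd ` ?H = {}" unfolding H2 G(4) using DM by auto
  ultimately have inj2: "inj_on snd (G \<union> ?H)" using G(2) by (auto simp: inj_on_Un)
  show ?thesis
    unfolding ABM_round_eq[OF R MN] matching_state_def prod.case image_Un H1 H2
    using inj1 inj2 G(3,4) by auto
qed

section \<open>Iterated rounds and the outcome of the mechanism\<close>

definition ABM_state ::
  "('n, 'm) profile \<Rightarrow> ('n \<times> 'n) set \<Rightarrow> nat \<Rightarrow> 'm set \<times> 'n set \<times> ('n \<times> 'm) set" where
  "ABM_state R p k = (ABM_round R p ^^ k) (UNIV, UNIV, {})"

lemma ABM_state_0: "ABM_state R p 0 = (UNIV, UNIV, {})"
  and ABM_state_Suc: "ABM_state R p (Suc k) = ABM_round R p (ABM_state R p k)"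
  by (simp_all add: ABM_state_def)

text \<open>The body fixes every state in which the loop has stopped, so \<open>k\<close> may exceed
  the actual number of iterations. This replaces the loop by a fixed number of rounds.\<close>

lemma while_eq_funpow:
  assumes "\<not> b ((c ^^ k) s)" "\<And>s. \<not> b s \<Longrightarrow> c s = s"
  shows "while b c s = (c ^^ k) s"
  using assms(1)
proof (induction k arbitrary: s)
  case 0
  then show ?case by (subst while_unfold) simp
next
  case (Suc k)
  then have IH: "while b c (c s) = (c ^^ Suc k) s" by (simp add: funpow_swap1)
  show ?case
  proof (cases "b s")
    case True
    then show ?thesis by (subst while_unfold) (simp only: IH if_True)
  next
    case False
    then show ?thesis using IH assms(2) by simp
  qed
qed

context
  fixes R :: "('n::finite, 'm::finite) profile" and p :: "('n \<times> 'n) set"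
  assumes card_eq: "CARD('n) = CARD('m)"
    and R: "preference_profile R" and p: "strict_linear_order p"
begin

lemma matching_state_empty:
  fixes G :: "('n \<times> 'm) set"
  shows "matching_state (M, N, G) \<Longrightarrow> M = {} \<longrightarrow> N = {}"
  using matching_state_card[OF card_eq, of M N G] by auto

lemma matching_state_ABM_state: "matching_state (ABM_state R p k)"
proof (induction k)
  case (Suc k)
  obtain M N G where s: "ABM_state R p k = (M, N, G)" by (cases "ABM_state R p k")
  show ?case
    using Suc matching_state_round[OF R p] matching_state_empty by (simp add: ABM_state_Suc s)
qed (simp add: ABM_state_0 matching_state_def)

lemma ABM_state_SucE:
  assumes "ABM_state R p k = (M, N, G)"
  shows "ABM_state R p (Suc k) =
    (M - demanded R N M, N - winner R p N M ` demanded R N M,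
     G \<union> (\<lambda>x. (winner R p N M x, x)) ` demanded R N M)"
  using ABM_round_eq[OF R] matching_state_empty matching_state_ABM_state[of k]
  by (simp add: assms ABM_state_Suc)

text \<open>While items remain, equally many agents remain, so at least one item is demanded and
  removed in each round.\<close>

lemma card_ABM_state: "card (fst (ABM_state R p k)) \<le> CARD('m) - k"
proof (induction k)
  case (Suc k)
  obtain M N G where s: "ABM_state R p k = (M, N, G)" by (cases "ABM_state R p k")
  have m: "matching_state (M, N, G)" using matching_state_ABM_state[of k] s by simp
  show ?case
  proof (cases "M = {}")
    case True
    then show ?thesis by (simp add: ABM_state_SucE[OF s])
  next
    case False
    then have "N \<noteq> {}" using matching_state_card[OF card_eq m] by auto
    then have "demanded R N M \<noteq> {}" by (simp add: demanded_def)
    then have "M - demanded R N M \<subset> M"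
      using demanded_subset[OF R matching_state_empty[OF m]] by blast
    then have "card (M - demanded R N M) < card M" by (intro psubset_card_mono) auto
    then show ?thesis using Suc by (simp add: ABM_state_SucE[OF s] s)
  qed
qed (simp add: ABM_state_0)

lemma ABM_state_final: "fst (ABM_state R p (CARD('m))) = {}"
  using card_ABM_state[of "CARD('m)"] by simp

lemma ABM_eq: "ABM R p j = (THE x. (j, x) \<in> snd (snd (ABM_state R p (CARD('m)))))"
proof -
  have "while (\<lambda>(M, N, G). M \<noteq> {}) (ABM_round R p) (UNIV, UNIV, {}) = ABM_state R p (CARD('m))"
    unfolding ABM_state_def
  proof (rule while_eq_funpow)
    show "\<not> (case (ABM_round R p ^^ CARD('m)) (UNIV, UNIV, {}) of (M, N, G) \<Rightarrow> M \<noteq> {})"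
      using ABM_state_final by (auto simp: ABM_state_def split: prod.splits)
    show "ABM_round R p s = s" if "\<not> (case s of (M, N, G) \<Rightarrow> M \<noteq> {})" for s
      using that by (auto simp: ABM_round_def split: prod.splits)
  qed
  then show ?thesis by (simp add: ABM_def case_prod_beta)
qed

text \<open>After \<open>CARD('m)\<close> rounds no item is left, hence no agent. The invariant then
  makes the recorded pairs the graph of a bijection, and the \<open>THE\<close> in
  \<open>ABM\<close> is well defined.\<close>

lemma ABM_graph:
  "bij (ABM R p) \<and> snd (snd (ABM_state R p (CARD('m)))) = {(j, ABM R p j) | j. True}"
proof -
  obtain M N G where s: "ABM_state R p (CARD('m)) = (M, N, G)"
    by (cases "ABM_state R p (CARD('m))")
  have m: "matching_state (M, N, G)" using matching_state_ABM_state[of "CARD('m)"] s by simp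
  have "M = {}" using ABM_state_final s by simp
  with matching_state_empty[OF m] have "N = {}" by simp
  from m have G: "inj_on fst G" "inj_on snd G" "fst ` G = UNIV" "snd ` G = UNIV"
    by (auto simp: matching_state_def \<open>M = {}\<close> \<open>N = {}\<close>)
  have un: "x = y" if "(j, x) \<in> G" "(j, y) \<in> G" for j x y
    using that G(1) by (metis fst_conv inj_onD snd_conv)
  have ABM_in: "(j, ABM R p j) \<in> G" for j
  proof -
    obtain x where "(j, x) \<in> G" using G(3) by (metis UNIV_I imageE prod.collapse)
    then show ?thesis unfolding ABM_eq s by (auto intro: theI2[of _ x] un)
  qed
  have graph: "G = {(j, ABM R p j) | j. True}"
    using ABM_in un by auto
  have "inj (ABM R p)"
    using G(2) ABM_in by (metis injI fst_conv inj_onD snd_conv)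
  moreover have "surj (ABM R p)"
    using G(4) unfolding graph by force
  ultimately show ?thesis using graph s by (simp add: bij_def)
qed

lemma ABM_state_mono: "snd (snd (ABM_state R p k)) \<subseteq> snd (snd (ABM_state R p (k + l)))"
proof (induction l)
  case (Suc l)
  obtain M N G where s: "ABM_state R p (k + l) = (M, N, G)" by (cases "ABM_state R p (k + l)")
  then show ?case using Suc ABM_state_SucE[OF s] by auto
qed simp

lemma ABM_state_subset: "snd (snd (ABM_state R p k)) \<subseteq> {(j, ABM R p j) | j. True}"
proof (cases "k \<le> CARD('m)")
  case True
  then show ?thesis using ABM_state_mono[of k "CARD('m) - k"] ABM_graph by simp
next
  case False
  \<comment> \<open>FERI concerns all round indices, so rounds past \<open>CARD('m)\<close> have to
    be covered too; there the state is stationary because no items are left.\<close>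
  have "ABM_state R p (CARD('m) + l) = ABM_state R p (CARD('m))" for l
  proof (induction l)
    case (Suc l)
    have "fst (ABM_state R p (CARD('m) + l)) = {}" using Suc ABM_state_final by simp
    then have "ABM_round R p (ABM_state R p (CARD('m) + l)) = ABM_state R p (CARD('m) + l)"
      by (cases "ABM_state R p (CARD('m) + l)") (simp add: ABM_round_def)
    then show ?case using Suc by (simp add: ABM_state_Suc)
  qed simp
  from this[of "k - CARD('m)"] show ?thesis using False ABM_graph by simp
qed

text \<open>Recorded pairs are never revised, so an agent leaves together with its final item. This
  expresses the remaining agents through the outcome alone, as the recursion for
  \<open>eager_items\<close> does.\<close>

lemma ABM_state_agents:
  assumes "ABM_state R p k = (M, N, G)"
  shows "N = {j. ABM R p j \<in> M}"
proof -
  have G: "fst ` G = - N" "snd ` G = - M" "G \<subseteq> {(j, ABM R p j) | j. True}"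
    using matching_state_ABM_state[of k] ABM_state_subset[of k] assms
    by (auto simp: matching_state_def)
  have "j \<in> - N \<longleftrightarrow> ABM R p j \<in> - M" for j
  proof
    assume "j \<in> - N"
    then obtain x where "(j, x) \<in> G" unfolding G(1)[symmetric] by auto
    then show "ABM R p j \<in> - M" using G(3) unfolding G(2)[symmetric] by force
  next
    assume "ABM R p j \<in> - M"
    then obtain i where i: "(i, ABM R p j) \<in> G" unfolding G(2)[symmetric] by auto
    then have "ABM R p j = ABM R p i" using G(3) by auto
    then have "i = j" using ABM_graph by (metis bij_def injD)
    with i show "j \<in> - N" unfolding G(1)[symmetric] by force
  qed
  then show ?thesis by blast
qed

end

section \<open>The sets of eager items, and FERI for outcomes of the mechanism\<close>

definition eager_upto :: "('n, 'm) profile \<Rightarrow> ('n \<Rightarrow> 'm) \<Rightarrow> nat \<Rightarrow> 'm set" where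
  "eager_upto R A k = (\<Union>r\<in>{1..<Suc k}. eager_items R A r)"

text \<open>This brings the recursion into the form of a mechanism round, with the not yet listed
  items and their owners as the remaining items and agents.\<close>

lemma eager_items_Suc:
  "eager_items R A (Suc k) = demanded R {j. A j \<notin> eager_upto R A k} (- eager_upto R A k)"
  by (subst eager_items.simps) (auto simp: eager_upto_def demanded_def Compl_eq_Diff_UNIV)

lemma eager_upto_0: "eager_upto R A 0 = {}"
  by (simp add: eager_upto_def)

lemma eager_upto_Suc: "eager_upto R A (Suc k) = eager_upto R A k \<union> eager_items R A (Suc k)"
  by (auto simp: eager_upto_def atLeastLessThanSuc)

lemma eager_upto_mono: "k \<le> l \<Longrightarrow> eager_upto R A k \<subseteq> eager_upto R A l"
  by (fastforce simp: eager_upto_def)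

text \<open>Rounds are counted from 1 in \<open>FERI\<close>; the shift \<open>r = Suc k\<close>
  makes \<open>k\<close> the number of completed rounds, matching \<open>ABM_state\<close>.\<close>

lemma FERI_iff:
  "FERI R A \<longleftrightarrow>
    (\<forall>k. \<forall>x\<in>eager_items R A (Suc k). x = best (R (inv A x)) (- eager_upto R A k))"
proof -
  have "FERI R A \<longleftrightarrow> (\<forall>r. \<forall>x\<in>eager_items R A (Suc r).
      x = best (R (inv A x)) (UNIV - (\<Union>r'\<in>{1..<Suc r}. eager_items R A r')))"
    unfolding FERI_def by (metis Suc_le_D Suc_le_mono One_nat_def le0)
  then show ?thesis by (simp add: eager_upto_def Compl_eq_Diff_UNIV)
qed

lemma FERI_ABM:
  fixes R :: "('n::finite, 'm::finite) profile"
  assumes card_eq: "CARD('n) = CARD('m)"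
    and R: "preference_profile R" and p: "strict_linear_order p"
  shows "FERI R (ABM R p)"
proof -
  let ?A = "ABM R p"
  note hyps = card_eq R p
  have A: "bij ?A" using ABM_graph[OF hyps] by simp
  \<comment> \<open>Both recursions remove the same \<open>demanded\<close> set at each step, since
    the agents left are those whose final item is left.\<close>
  have fst_eq: "fst (ABM_state R p k) = - eager_upto R ?A k" for k
  proof (induction k)
    case (Suc k)
    obtain M N G where s: "ABM_state R p k = (M, N, G)" by (cases "ABM_state R p k")
    show ?case
      using Suc ABM_state_agents[OF hyps s]
      by (auto simp: ABM_state_SucE[OF hyps s] s eager_upto_Suc eager_items_Suc)
  qed (simp add: ABM_state_0 eager_upto_0)
  show ?thesis
    unfolding FERI_iff
  proof (intro allI ballI)
    fix k x assume x: "x \<in> eager_items R ?A (Suc k)"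
    obtain M N G where s: "ABM_state R p k = (M, N, G)" by (cases "ABM_state R p k")
    have M: "M = - eager_upto R ?A k" using fst_eq[of k] s by simp
    have N: "N = {j. ?A j \<notin> eager_upto R ?A k}"
      using ABM_state_agents[OF hyps s] M by auto
    have xD: "x \<in> demanded R N M" using x by (simp add: eager_items_Suc M N)
    \<comment> \<open>The pair is recorded in the next state and hence belongs to the outcome, so
      the winner is the owner of \<open>x\<close>.\<close>
    then have "(winner R p N M x, x) \<in> {(j, ?A j) | j. True}"
      using ABM_state_subset[OF hyps, of "Suc k"] by (auto simp: ABM_state_SucE[OF hyps s])
    then have "inv ?A x = winner R p N M x"
      using A by (intro inv_f_eq) (auto simp: bij_is_inj)
    then show "x = best (R (inv ?A x)) (- eager_upto R ?A k)"
      using winner_applies(2)[OF p xD] M by simp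
  qed
qed

section \<open>A priority order that produces a given FERI assignment\<close>

lemma strict_linear_order_refining:
  fixes f :: "'a::finite \<Rightarrow> nat"
  obtains p where "strict_linear_order p" "\<And>i j. f i < f j \<Longrightarrow> (i, j) \<in> p"
proof -
  \<comment> \<open>An injective numbering breaks ties between elements with equal
    \<open>f\<close>.\<close>
  obtain g :: "'a \<Rightarrow> nat" where g: "inj g"
    using finite_imp_inj_to_nat_seg[of "UNIV :: 'a set"] by auto
  let ?p = "{(i, j). f i < f j \<or> f i = f j \<and> g i < g j}"
  have "strict_linear_order ?p"
    using g by (auto simp: strict_linear_order_on_def trans_def irrefl_def total_on_def
        dest: injD intro: linorder_neqE_nat)
  then show ?thesis by (rule that) auto
qed

lemma FERI_imp_ABM:
  fixes R :: "('n::finite, 'm::finite) profile"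
  assumes card_eq: "CARD('n) = CARD('m)"
    and R: "preference_profile R" and A: "bij A" and F: "FERI R A"
  obtains p where "strict_linear_order p" "ABM R p = A"
proof -
  let ?K = "CARD('m)" and ?E = "eager_upto R A"
  \<comment> \<open>One less than the round in which the item of \<open>j\<close> appears.\<close>
  define f where "f j = card {k. k < ?K \<and> A j \<notin> ?E (Suc k)}" for j
  obtain p where p: "strict_linear_order p" and fp: "\<And>i j. f i < f j \<Longrightarrow> (i, j) \<in> p"
    using strict_linear_order_refining by blast
  note hyps = card_eq R p
  \<comment> \<open>The sets \<open>?E\<close> increase, so the indices counted for \<open>i\<close>
    all lie below \<open>k\<close>, while those counted for \<open>j\<close> include all of these
    and \<open>k\<close> itself.\<close>
  have earlier: "(i, j) \<in> p" if "k < ?K" "A i \<in> ?E (Suc k)" "A j \<notin> ?E (Suc k)" for i j k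
  proof (rule fp)
    have "l < k" if "A i \<notin> ?E (Suc l)" for l
      using that \<open>A i \<in> ?E (Suc k)\<close> eager_upto_mono[of "Suc k" "Suc l" R A] by (meson Suc_le_mono not_le subsetD)
    moreover have "A j \<notin> ?E (Suc l)" if "l < k" for l
      using that \<open>A j \<notin> ?E (Suc k)\<close> eager_upto_mono[of "Suc l" "Suc k" R A] by auto
    ultimately have "{l. l < ?K \<and> A i \<notin> ?E (Suc l)} \<subset> {l. l < ?K \<and> A j \<notin> ?E (Suc l)}"
      using that by blast
    then show "f i < f j" unfolding f_def by (intro psubset_card_mono) auto
  qed
  have inv_A: "A (inv A x) = x" for x using A by (simp add: bij_is_surj surj_f_inv_f)
  \<comment> \<open>The run is determined round by round: under \<open>p\<close> the winners are the
    owners in \<open>A\<close>. The bound on \<open>k\<close> is there because \<open>f\<close>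
    distinguishes only the first \<open>?K\<close> rounds.\<close>
  have state: "k \<le> ?K \<Longrightarrow>
      ABM_state R p k = (- ?E k, {j. A j \<notin> ?E k}, {(j, A j) | j. A j \<in> ?E k})" for k
  proof (induction k)
    case (Suc k)
    let ?M = "- ?E k" and ?N = "{j. A j \<notin> ?E k}" and ?T = "eager_items R A (Suc k)"
    have s: "ABM_state R p k = (?M, ?N, {(j, A j) | j. A j \<in> ?E k})" using Suc by simp
    have T: "demanded R ?N ?M = ?T" by (simp add: eager_items_Suc)
    have "?M = {} \<longrightarrow> ?N = {}" by auto
    then have TM: "?T \<subseteq> ?M" using demanded_subset[OF R] T by metis
    have top: "best (R (inv A x)) ?M = x" if "x \<in> ?T" for x
      using F that unfolding FERI_iff by metis
    have w: "winner R p ?N ?M x = inv A x" if x: "x \<in> ?T" for x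
      unfolding winner_def
    proof (rule best_eqI[OF p])
      show "inv A x \<in> {j \<in> ?N. best (R j) ?M = x}"
        using x TM top inv_A by auto
      fix j assume j: "j \<in> {j \<in> ?N. best (R j) ?M = x}" "j \<noteq> inv A x"
      have "inv A (A j) = j" using A by (simp add: bij_is_inj)
      then have "A j \<notin> ?T" using top[of "A j"] j by auto
      then have "A j \<notin> ?E (Suc k)" using j by (simp add: eager_upto_Suc)
      moreover have "A (inv A x) \<in> ?E (Suc k)" using x by (simp add: inv_A eager_upto_Suc)
      ultimately show "(inv A x, j) \<in> p" using earlier[of k "inv A x" j] Suc.prems by auto
    qed
    have "winner R p ?N ?M ` ?T = inv A ` ?T" using w by auto
    also have "\<dots> = {j. A j \<in> ?T}"
      using A by (metis bij_imp_bij_inv bij_vimage_eq_inv_image vimage_def inv_inv_eq)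
    finally have wT: "winner R p ?N ?M ` ?T = {j. A j \<in> ?T}" .
    have "(\<lambda>x. (winner R p ?N ?M x, x)) ` ?T = (\<lambda>x. (inv A x, x)) ` ?T"
      using w by auto
    also have "\<dots> = {(j, A j) | j. A j \<in> ?T}"
      using A inv_A by (auto simp: image_iff bij_is_inj)
    finally have wG: "(\<lambda>x. (winner R p ?N ?M x, x)) ` ?T = {(j, A j) | j. A j \<in> ?T}" .
    show ?case
      unfolding ABM_state_SucE[OF hyps s] T wT wG by (auto simp: eager_upto_Suc)
  qed (simp add: ABM_state_0 eager_upto_0)
  have "?E ?K = UNIV"
    using ABM_state_final[OF hyps] state[of ?K] by auto
  then have "{(j, A j) | j. True} = {(j, ABM R p j) | j. True}"
    using ABM_graph[OF hyps] state[of ?K] by simp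
  then have "ABM R p = A" by (auto simp: set_eq_iff)
  with p that show ?thesis by blast
qed

section \<open>Convex combinations of outcomes and distributions over priority orders\<close>

theorem theorem2:
  fixes R :: "('n::finite, 'm::finite) profile"
    and P :: "real^'m^'n"
  assumes "CARD('n) = CARD('m)"
    and "preference_profile R"
    and "random_assignment P"
  shows "ep_FERI R P \<longleftrightarrow>
    (\<exists>\<pi> :: ('n \<times> 'n) set pmf.
       set_pmf \<pi> \<subseteq> {p. strict_linear_order p} \<and> P = expected_ABM R \<pi>)"
proof
  let ?B = "{A. bij A \<and> FERI R A}" and ?L = "{p :: ('n \<times> 'n) set. strict_linear_order p}"
  {
    assume "ep_FERI R P"
    then obtain w where w0: "\<And>A. A \<in> ?B \<Longrightarrow> 0 \<le> w A" and w1: "(\<Sum>A\<in>?B. w A) = 1"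
      and P: "P = (\<Sum>A\<in>?B. w A *\<^sub>R assignment_matrix A)"
      unfolding ep_FERI_def by blast
    have "\<forall>A\<in>?B. \<exists>p. strict_linear_order p \<and> ABM R p = A"
      using FERI_imp_ABM[OF assms(1,2)] by blast
    from bchoice[OF this] obtain q
      where qA: "\<forall>A\<in>?B. strict_linear_order (q A) \<and> ABM R (q A) = A"
      by (elim exE)
    have q: "strict_linear_order (q A)" if "A \<in> ?B" for A
      using bspec[OF qA that] by (rule conjunct1)
    have Aq: "ABM R (q A) = A" if "A \<in> ?B" for A
      using bspec[OF qA that] by (rule conjunct2)
    have inj: "inj_on q ?B" by (rule inj_on_inverseI[of _ "ABM R"]) (rule Aq)
    \<comment> \<open>Each FERI assignment \<open>A\<close> passes its weight to the single chosen
      order \<open>q A\<close>. Distinct assignments use distinct orders because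
      \<open>ABM R\<close> recovers \<open>A\<close> from \<open>q A\<close>.\<close>
    define u where "u p = (if p \<in> q ` ?B then w (ABM R p) else 0)" for p
    have u0: "0 \<le> u p" for p using w0 Aq by (auto simp: u_def)
    have uq: "u (q A) = w A" if "A \<in> ?B" for A using Aq[OF that] that by (auto simp: u_def)
    have "(\<Sum>p\<in>UNIV. u p) = (\<Sum>p\<in>q ` ?B. u p)"
      by (rule sum.mono_neutral_right) (auto simp: u_def)
    also have "\<dots> = (\<Sum>A\<in>?B. w A)"
      by (simp add: sum.reindex[OF inj] uq)
    finally have "(\<Sum>p\<in>UNIV. u p) = 1" using w1 by simp
    then have "(\<integral>\<^sup>+p. ennreal (u p) \<partial>count_space UNIV) = 1"
      by (simp add: nn_integral_count_space_finite u0 sum_ennreal)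
    then have pmf: "pmf (embed_pmf u) p = u p" for p
      using u0 by (intro pmf_embed_pmf) auto
    have "set_pmf (embed_pmf u) \<subseteq> ?L"
      using q by (auto simp: set_pmf_eq pmf u_def split: if_splits)
    moreover have "expected_ABM R (embed_pmf u) = (\<Sum>p\<in>q ` ?B. u p *\<^sub>R assignment_matrix (ABM R p))"
      unfolding expected_ABM_def pmf
      by (rule sum.mono_neutral_right) (use q in \<open>auto simp: u_def\<close>)
    moreover have "\<dots> = P"
      unfolding P sum.reindex[OF inj] by (rule sum.cong) (use uq Aq in auto)
    ultimately show "\<exists>\<pi>. set_pmf \<pi> \<subseteq> ?L \<and> P = expected_ABM R \<pi>"
      by (intro exI[of _ "embed_pmf u"]) auto
  next
    assume "\<exists>\<pi>. set_pmf \<pi> \<subseteq> ?L \<and> P = expected_ABM R \<pi>"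
    then obtain \<pi> where \<pi>: "set_pmf \<pi> \<subseteq> ?L" and P: "P = expected_ABM R \<pi>" by blast
    have AB: "ABM R ` ?L \<subseteq> ?B"
      using ABM_graph[OF assms(1,2)] FERI_ABM[OF assms(1,2)] by blast
    \<comment> \<open>Different orders may yield the same assignment, so their probabilities are
      added; \<open>sum.group\<close> regroups sums over orders by outcome.\<close>
    define w where "w A = (\<Sum>p\<in>{p \<in> ?L. ABM R p = A}. pmf \<pi> p)" for A
    have "(\<Sum>A\<in>?B. w A) = (\<Sum>p\<in>?L. pmf \<pi> p)"
      unfolding w_def by (rule sum.group[OF _ _ AB]) auto
    also have "\<dots> = 1" by (rule sum_pmf_eq_1) (use \<pi> in auto)
    finally have w1: "(\<Sum>A\<in>?B. w A) = 1" .
    have "w A *\<^sub>R assignment_matrix A =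
        (\<Sum>p\<in>{p \<in> ?L. ABM R p = A}. pmf \<pi> p *\<^sub>R assignment_matrix (ABM R p))" for A
      unfolding w_def scaleR_sum_left by (rule sum.cong) auto
    then have "(\<Sum>A\<in>?B. w A *\<^sub>R assignment_matrix A) = P"
      unfolding P expected_ABM_def
      using sum.group[OF _ _ AB, of "\<lambda>p. pmf \<pi> p *\<^sub>R assignment_matrix (ABM R p)"] by simp
    moreover have "0 \<le> w A" for A by (simp add: w_def sum_nonneg)
    ultimately show "ep_FERI R P" unfolding ep_FERI_def using w1
      by (intro exI[of _ w]) auto
  }
qed

end
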